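(* Let $\phi^0$ be given and let $\phi^{n}$, $n=1,\dots,N$, be generated by the stabilized time-discrete semi-implicit scheme $$\Big(\frac1\tau+\frac\kappa\epsilon\Big)(\phi^{n+1}-\phi^n)=\epsilon\Delta\phi^{n+1}-\frac1\epsilon W'(\phi^n)-\gamma\big[(-\Delta)^{-1}(f(\phi^n)-\omega)\big]f'(\phi^n)-M\Big(\int_{\mathbb{T}^d}(f(\phi^n)-\omega)\,dx\Big)f'(\phi^n)$$ on $\mathbb{T}^d$ with periodic boundary conditions. Suppose $$\frac1\tau+\frac\kappa\epsilon\ \ge\ \frac{L_{W''}}{\epsilon}+\tilde\omega L_{f''}\Big(\gamma\|(-\Delta)^{-1}\|+M|\mathbb{T}^d|\Big).$$ If $0\le\phi^0\le1$, then $0\le\phi^n\le1$ for all $n\in\{1,\dots,N\}$.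
   Context: $\mathbb{T}^d=\prod_{i=1}^d[-X_i,X_i]\subset\mathbb{R}^d$, $d=2,3$, is a periodic box. The parameters are $\epsilon>0$, $\gamma>0$, $M>0$, $\kappa>0$, $\omega\in(0,1)$, $\tilde\omega=\max\{\omega,1-\omega\}$; $T>0$, $N>0$ is an integer, $\tau=T/N$. $W(s)=18(s^2-s)^2$, $f(s)=3s^2-2s^3$ (not extended), $L_{W''}=\|W''\|_{L^\infty[0,1]}$, $L_{f''}=\|f''\|_{L^\infty[0,1]}$. For $g$ on $\mathbb{T}^d$, $(-\Delta)^{-1}g$ is the periodic mean-zero function $u$ with $-\Delta u=g-\frac{1}{|\mathbb{T}^d|}\int_{\mathbb{T}^d}g\,dx$, and $\|(-\Delta)^{-1}\|$ is its operator norm from $L^\infty(\mathbb{T}^d)$ to itself. At each step $\phi^{n+1}$ is the unique periodic solution of the (linear in $\phi^{n+1}$) equation. *)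

theory Defs
  imports "HOL-Analysis.Analysis" "HOL-Probability.Essential_Supremum"
begin

definition W_pot :: "real \<Rightarrow> real" where
  "W_pot s = 18 * (s\<^sup>2 - s)\<^sup>2"

definition f_int :: "real \<Rightarrow> real" where
  "f_int s = 3 * s\<^sup>2 - 2 * s^3"

(* Values in ereal: infinite for functions that are not essentially bounded,
   or not measurable. *)
definition Linf_norm :: "'a measure \<Rightarrow> ('a \<Rightarrow> real) \<Rightarrow> ereal" where
  "Linf_norm A g = esssup A (\<lambda>x. ereal \<bar>g x\<bar>)"

(* A function on the torus is represented by a function on the whole space that is
   periodic with period 2 * X $ i in the i-th coordinate; integrals and null sets
   are taken over one period cell. *)
definition torus :: "real^'d \<Rightarrow> (real^'d) measure" where
  "torus X = lebesgue_on (cbox (- X) X)"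

definition torus_vol :: "real^'d \<Rightarrow> real" where
  "torus_vol X = measure (torus X) (space (torus X))"

definition periodic :: "real^'d \<Rightarrow> (real^'d \<Rightarrow> real) \<Rightarrow> bool" where
  "periodic X u \<longleftrightarrow> (\<forall>x i. u (x + axis i (2 * X $ i)) = u x)"

definition partial_deriv :: "'d \<Rightarrow> (real^'d \<Rightarrow> real) \<Rightarrow> real^'d \<Rightarrow> real" where
  "partial_deriv i u x = frechet_derivative u (at x) (axis i 1)"

definition laplacian :: "(real^'d \<Rightarrow> real) \<Rightarrow> real^'d \<Rightarrow> real" where
  "laplacian u x = (\<Sum>i\<in>UNIV. partial_deriv i (partial_deriv i u) x)"

primrec C_k :: "nat \<Rightarrow> (real^'d \<Rightarrow> real) \<Rightarrow> bool" where
  "C_k 0 u \<longleftrightarrow> continuous_on UNIV u"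
| "C_k (Suc k) u \<longleftrightarrow> (\<forall>x. u differentiable (at x)) \<and> (\<forall>i. C_k k (partial_deriv i u))"

definition test_function :: "real^'d \<Rightarrow> (real^'d \<Rightarrow> real) \<Rightarrow> bool" where
  "test_function X \<psi> \<longleftrightarrow> periodic X \<psi> \<and> (\<forall>k. C_k k \<psi>)"

(* Distributional Laplacian on the torus. Boundary terms are excluded because the test
   functions are periodic rather than compactly supported in the open cell, so this
   encodes the periodic boundary conditions. It determines w up to null sets. *)
definition weak_laplacian :: "real^'d \<Rightarrow> (real^'d \<Rightarrow> real) \<Rightarrow> (real^'d \<Rightarrow> real) \<Rightarrow> bool" where
  "weak_laplacian X u w \<longleftrightarrow>
     integrable (torus X) u \<and> integrable (torus X) w \<and>
     (\<forall>\<psi>. test_function X \<psi> \<longrightarrow>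
        (LINT x|torus X. u x * laplacian \<psi> x) = (LINT x|torus X. w x * \<psi> x))"

(* u is (a representative of) the inverse of the negative Laplacian applied to g. *)
definition is_inv_neg_laplacian ::
    "real^'d \<Rightarrow> (real^'d \<Rightarrow> real) \<Rightarrow> (real^'d \<Rightarrow> real) \<Rightarrow> bool" where
  "is_inv_neg_laplacian X g u \<longleftrightarrow>
     periodic X u \<and>
     weak_laplacian X u (\<lambda>x. - (g x - (LINT y|torus X. g y) / torus_vol X)) \<and>
     (LINT x|torus X. u x) = 0"

definition inv_neg_laplacian_norm :: "real^'d \<Rightarrow> ereal" where
  "inv_neg_laplacian_norm X =
     Sup {Linf_norm (torus X) u | g u.
            periodic X g \<and> Linf_norm (torus X) g \<le> 1 \<and> is_inv_neg_laplacian X g u}"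

(* v and w represent the nonlocal term and the Laplacian of q; both are determined by
   p and q up to null sets. *)
definition scheme_step ::
    "real^'d \<Rightarrow> real \<Rightarrow> real \<Rightarrow> real \<Rightarrow> real \<Rightarrow> real \<Rightarrow> real \<Rightarrow>
     (real^'d \<Rightarrow> real) \<Rightarrow> (real^'d \<Rightarrow> real) \<Rightarrow> bool" where
  "scheme_step X \<epsilon> \<gamma> M \<kappa> \<omega> \<tau> p q \<longleftrightarrow>
     periodic X q \<and>
     (\<exists>v w. is_inv_neg_laplacian X (\<lambda>x. f_int (p x) - \<omega>) v \<and>
            weak_laplacian X q w \<and>
            (AE x in torus X.
               (1 / \<tau> + \<kappa> / \<epsilon>) * (q x - p x) =
                 \<epsilon> * w x - 1 / \<epsilon> * deriv W_pot (p x)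
                 - \<gamma> * v x * deriv f_int (p x)
                 - M * (LINT y|torus X. f_int (p y) - \<omega>) * deriv f_int (p x)))"

end

theory Submission
  imports Defs
begin

text \<open>
  Write \<open>c = 1/\<tau> + \<kappa>/\<epsilon>\<close>. One step of the scheme reads \<open>c q - \<epsilon> \<Delta>q = h\<close> with
  \<open>h = c p - W'(p)/\<epsilon> - A f'(p)\<close> and \<open>A = \<gamma> (-\<Delta>)\<^sup>-\<^sup>1(f(p) - \<omega>) + M \<integral> (f(p) - \<omega>)\<close>. If \<open>0 \<le> p \<le> 1\<close>,
  then \<open>|f(p) - \<omega>| \<le> max \<omega> (1 - \<omega>)\<close>, which bounds \<open>A\<close>; the stability condition then says that
  the stabilization dominates, and since \<open>W'\<close> and \<open>f'\<close> vanish at 0 and 1 it follows that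
  \<open>0 \<le> h \<le> c\<close> (\<open>source_bounds\<close>). The maximum principle for \<open>c - \<epsilon> \<Delta>\<close> gives \<open>0 \<le> q \<le> 1\<close>, and
  the theorem follows by induction on the step.

  The solution \<open>q\<close> is only an integrable function with a distributional Laplacian, so the maximum
  principle is proved by duality (\<open>weak_maximum_principle\<close>). For a nonnegative trigonometric
  polynomial \<open>\<eta>\<close> the adjoint problem \<open>c \<psi> - \<epsilon> \<Delta>\<psi> = \<eta>\<close> is solved mode by mode by another
  trigonometric polynomial (\<open>trig_poly_resolvent\<close>), which is nonnegative by the classical maximum
  principle (\<open>trig_poly_max_principle\<close>). Testing with \<open>\<psi>\<close> shows \<open>\<integral> q \<eta> \<ge> 0\<close>, and by the
  Stone-Weierstrass theorem there are enough such \<open>\<eta>\<close> to conclude \<open>q \<ge> 0\<close> almost everywhere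
  (\<open>AE_nonneg_if_trig_poly_integrals_nonneg\<close>). The upper bound is the same statement for
  \<open>1 - q\<close>; it also needs that Laplacians of trigonometric polynomials have mean zero
  (\<open>integral_laplacian_eq_0\<close>).
\<close>

section \<open>Trigonometric polynomials on the torus\<close>

text \<open>
  The real trigonometric polynomials on the torus: finite sums of modes
  \<open>a cos (\<xi> \<bullet> x + \<theta>)\<close> whose frequency \<open>\<xi>\<close> lies in the dual lattice, i.e. each \<open>\<xi>\<^sub>i X\<^sub>i / \<pi>\<close>
  is an integer. The phase \<open>\<theta>\<close> makes sines unnecessary and keeps the class closed under
  partial derivatives, which shift the phase by \<open>\<pi> / 2\<close>.
\<close>

inductive trig_poly :: "real^'d \<Rightarrow> (real^'d \<Rightarrow> real) \<Rightarrow> bool" for X :: "real^'d" where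
  mode: "(\<And>i. \<xi> $ i * X $ i / pi \<in> \<int>) \<Longrightarrow> trig_poly X (\<lambda>x. a * cos (\<xi> \<bullet> x + \<theta>))"
| add: "trig_poly X u \<Longrightarrow> trig_poly X v \<Longrightarrow> trig_poly X (\<lambda>x. u x + v x)"

lemma trig_poly_const: "trig_poly X (\<lambda>x. a)"
  using trig_poly.mode[of 0 X a 0] by simp

lemma trig_poly_cmult:
  assumes "trig_poly X u"
  shows "trig_poly X (\<lambda>x. b * u x)"
  using assms
proof induction
  case (mode \<xi> a \<theta>)
  then show ?case
    using trig_poly.mode[of \<xi> X "b * a" \<theta>] by (simp add: mult.assoc)
next
  case (add u v)
  then show ?case
    using trig_poly.add by (simp add: distrib_left)
qed

lemma trig_poly_sum:
  assumes "\<And>i. i \<in> I \<Longrightarrow> trig_poly X (u i)"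
  shows "trig_poly X (\<lambda>x. \<Sum>i\<in>I. u i x)"
  using assms
  by (induction I rule: infinite_finite_induct) (auto intro: trig_poly_const trig_poly.add)

lemma trig_poly_mult:
  assumes "trig_poly X u" "trig_poly X v"
  shows "trig_poly X (\<lambda>x. u x * v x)"
  using assms(1)
proof induction
  case (mode \<xi> a \<theta>)
  note \<xi> = mode
  show ?case
    using assms(2)
  proof induction
    case (mode \<eta> b \<zeta>)
    have 1: "trig_poly X (\<lambda>x. (a * b / 2) * cos ((\<xi> - \<eta>) \<bullet> x + (\<theta> - \<zeta>)))"
      by (rule trig_poly.mode) (use \<xi> mode in \<open>simp add: left_diff_distrib diff_divide_distrib\<close>)
    have 2: "trig_poly X (\<lambda>x. (a * b / 2) * cos ((\<xi> + \<eta>) \<bullet> x + (\<theta> + \<zeta>)))"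
      by (rule trig_poly.mode) (use \<xi> mode in \<open>simp add: distrib_right add_divide_distrib\<close>)
    have "a * cos (\<xi> \<bullet> x + \<theta>) * (b * cos (\<eta> \<bullet> x + \<zeta>)) =
        (a * b / 2) * cos ((\<xi> - \<eta>) \<bullet> x + (\<theta> - \<zeta>)) +
        (a * b / 2) * cos ((\<xi> + \<eta>) \<bullet> x + (\<theta> + \<zeta>))" for x
    proof -
      have "cos ((\<xi> - \<eta>) \<bullet> x + (\<theta> - \<zeta>)) = cos ((\<xi> \<bullet> x + \<theta>) - (\<eta> \<bullet> x + \<zeta>))"
        "cos ((\<xi> + \<eta>) \<bullet> x + (\<theta> + \<zeta>)) = cos ((\<xi> \<bullet> x + \<theta>) + (\<eta> \<bullet> x + \<zeta>))"
        by (simp_all add: inner_diff_left inner_add_left algebra_simps)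
      then show ?thesis
        by (simp only: cos_diff cos_add) (simp add: algebra_simps)
    qed
    then show ?case
      using trig_poly.add[OF 1 2] by presburger
  next
    case (add u v)
    then show ?case
      using trig_poly.add by (simp add: distrib_left)
  qed
next
  case (add u v)
  then show ?case
    using trig_poly.add by (simp add: distrib_right)
qed

text \<open>
  Periodicity under all vectors of the period lattice at once, not only under the coordinate
  shifts of \<open>periodic\<close>; it moves any point into the closed period cell.
\<close>

lemma trig_poly_lattice_periodic:
  assumes "trig_poly X u" "\<And>i. z $ i = 2 * X $ i * of_int (n i)"
  shows "u (x + z) = u x"
  using assms(1)
proof induction
  case (mode \<xi> a \<theta>)
  have "\<xi> \<bullet> z = (\<Sum>i\<in>UNIV. 2 * pi * ((\<xi> $ i * X $ i / pi) * of_int (n i)))"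
    by (simp add: inner_vec_def assms(2) algebra_simps)
  also have "\<dots> = 2 * pi * (\<Sum>i\<in>UNIV. (\<xi> $ i * X $ i / pi) * of_int (n i))"
    by (simp add: sum_distrib_left)
  also have "(\<Sum>i\<in>UNIV. (\<xi> $ i * X $ i / pi) * of_int (n i)) \<in> \<int>"
    using mode by (intro Ints_sum Ints_mult) auto
  then obtain k where "(\<Sum>i\<in>UNIV. (\<xi> $ i * X $ i / pi) * of_int (n i)) = of_int k"
    by (elim Ints_cases)
  finally have z: "\<xi> \<bullet> z = 2 * pi * of_int k" by simp
  have "cos (\<xi> \<bullet> (x + z) + \<theta>) = cos (\<xi> \<bullet> x + \<theta> + 2 * pi * of_int k)"
    by (simp add: inner_add_right z algebra_simps)
  also have "\<dots> = cos (\<xi> \<bullet> x + \<theta>)"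
    by (simp only: cos_add cos_int_2pin sin_int_2pin) simp
  finally show ?case by simp
qed simp

lemma trig_poly_periodic:
  assumes "trig_poly X u"
  shows "periodic X u"
  unfolding periodic_def
proof (intro allI)
  fix x i
  show "u (x + axis i (2 * X $ i)) = u x"
    by (rule trig_poly_lattice_periodic[OF assms, where n="\<lambda>j. if j = i then 1 else 0"])
      (simp add: axis_def)
qed

section \<open>Derivatives of trigonometric polynomials\<close>

lemma partial_deriv_eq:
  assumes "(u has_derivative D) (at x)"
  shows "partial_deriv i u x = D (axis i 1)"
  unfolding partial_deriv_def using frechet_derivative_at[OF assms] by simp

lemma partial_deriv_add:
  assumes "u differentiable (at x)" "v differentiable (at x)"
  shows "partial_deriv i (\<lambda>x. u x + v x) x = partial_deriv i u x + partial_deriv i v x"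
proof -
  have "((\<lambda>x. u x + v x) has_derivative
      (\<lambda>h. frechet_derivative u (at x) h + frechet_derivative v (at x) h)) (at x)"
    using assms by (intro has_derivative_add) (simp_all add: frechet_derivative_works[symmetric])
  from partial_deriv_eq[OF this] show ?thesis
    by (simp add: partial_deriv_def)
qed

lemma has_derivative_mode:
  "((\<lambda>x::real^'d. a * cos (\<xi> \<bullet> x + \<theta>)) has_derivative (\<lambda>h. - a * sin (\<xi> \<bullet> x + \<theta>) * (\<xi> \<bullet> h))) (at x)"
  by (auto intro!: derivative_eq_intros)

lemma partial_deriv_mode:
  "partial_deriv i (\<lambda>x::real^'d. a * cos (\<xi> \<bullet> x + \<theta>)) =
    (\<lambda>x. (a * \<xi> $ i) * cos (\<xi> \<bullet> x + (\<theta> + pi / 2)))"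
proof
  fix x :: "real^'d"
  have "cos (\<xi> \<bullet> x + (\<theta> + pi / 2)) = - sin (\<xi> \<bullet> x + \<theta>)"
    by (simp add: add.assoc[symmetric] cos_add)
  then show "partial_deriv i (\<lambda>x. a * cos (\<xi> \<bullet> x + \<theta>)) x =
      (a * \<xi> $ i) * cos (\<xi> \<bullet> x + (\<theta> + pi / 2))"
    by (simp add: partial_deriv_eq[OF has_derivative_mode] inner_axis)
qed

lemma laplacian_mode:
  "laplacian (\<lambda>x::real^'d. a * cos (\<xi> \<bullet> x + \<theta>)) x = - (\<xi> \<bullet> \<xi>) * (a * cos (\<xi> \<bullet> x + \<theta>))"
proof -
  have "cos (\<xi> \<bullet> x + (\<theta> + pi / 2 + pi / 2)) = - cos (\<xi> \<bullet> x + \<theta>)"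
    by (simp add: add.assoc[symmetric] cos_add sin_add)
  then have "laplacian (\<lambda>x. a * cos (\<xi> \<bullet> x + \<theta>)) x =
      (\<Sum>i\<in>UNIV. (\<xi> $ i * \<xi> $ i) * - (a * cos (\<xi> \<bullet> x + \<theta>)))"
    unfolding laplacian_def partial_deriv_mode by (intro sum.cong) auto
  also have "\<dots> = (\<xi> \<bullet> \<xi>) * - (a * cos (\<xi> \<bullet> x + \<theta>))"
    by (subst sum_distrib_right[symmetric]) (simp add: inner_vec_def)
  finally show ?thesis by simp
qed

lemma trig_poly_differentiable:
  assumes "trig_poly X u"
  shows "u differentiable (at x)"
  using assms
proof induction
  case (mode \<xi> a \<theta>)
  show ?case using has_derivative_mode by (rule differentiableI)
qed simp

lemma trig_poly_partial_deriv:
  assumes "trig_poly X u"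
  shows "trig_poly X (partial_deriv i u)"
  using assms
proof induction
  case (mode \<xi> a \<theta>)
  then show ?case unfolding partial_deriv_mode by (rule trig_poly.mode)
next
  case (add u v)
  have "partial_deriv i (\<lambda>x. u x + v x) = (\<lambda>x. partial_deriv i u x + partial_deriv i v x)"
    using add.hyps by (intro ext partial_deriv_add trig_poly_differentiable)
  then show ?case using trig_poly.add[OF add.IH] by simp
qed

lemma trig_poly_continuous:
  assumes "trig_poly X u"
  shows "continuous_on S u"
  by (intro continuous_at_imp_continuous_on ballI differentiable_imp_continuous_within
      trig_poly_differentiable[OF assms])

lemma trig_poly_C_k: "trig_poly X u \<Longrightarrow> C_k k u"
  by (induction k arbitrary: u)
    (auto intro: trig_poly_continuous trig_poly_differentiable trig_poly_partial_deriv)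

lemma trig_poly_test_function: "trig_poly X u \<Longrightarrow> test_function X u"
  by (simp add: test_function_def trig_poly_periodic trig_poly_C_k)

lemma trig_poly_laplacian: "trig_poly X u \<Longrightarrow> trig_poly X (laplacian u)"
  unfolding laplacian_def[abs_def] by (intro trig_poly_sum trig_poly_partial_deriv)

lemma laplacian_add:
  assumes "trig_poly X u" "trig_poly X v"
  shows "laplacian (\<lambda>x. u x + v x) x = laplacian u x + laplacian v x"
proof -
  have "partial_deriv i (\<lambda>x. u x + v x) = (\<lambda>x. partial_deriv i u x + partial_deriv i v x)" for i
    using assms by (intro ext partial_deriv_add trig_poly_differentiable)
  moreover have "partial_deriv i (\<lambda>x. partial_deriv i u x + partial_deriv i v x) x =
      partial_deriv i (partial_deriv i u) x + partial_deriv i (partial_deriv i v) x" for i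
    using assms
    by (intro partial_deriv_add trig_poly_differentiable[where X=X] trig_poly_partial_deriv)
  ultimately show ?thesis
    by (simp add: laplacian_def sum.distrib)
qed

section \<open>The equation \<open>c \<psi> - \<epsilon> \<Delta>\<psi> = \<eta>\<close> and its maximum principle\<close>

text \<open>
  A mode is an eigenfunction of the Laplacian, so \<open>c \<psi> - \<epsilon> \<Delta>\<psi> = \<eta>\<close> is solved by dividing the
  coefficient of each mode by \<open>c + \<epsilon> |\<xi>|\<^sup>2\<close>.
\<close>

lemma trig_poly_resolvent:
  assumes "trig_poly X \<eta>" and c: "c > 0" and \<epsilon>: "\<epsilon> > 0"
  obtains \<psi> where "trig_poly X \<psi>" "\<And>x. c * \<psi> x - \<epsilon> * laplacian \<psi> x = \<eta> x"
proof -
  have "\<exists>\<psi>. trig_poly X \<psi> \<and> (\<forall>x. c * \<psi> x - \<epsilon> * laplacian \<psi> x = \<eta> x)"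
    using assms(1)
  proof induction
    case (mode \<xi> a \<theta>)
    have pos: "c + \<epsilon> * (\<xi> \<bullet> \<xi>) > 0"
      using c \<epsilon> by (simp add: add_pos_nonneg)
    define b where "b = a / (c + \<epsilon> * (\<xi> \<bullet> \<xi>))"
    have b: "a = (c + \<epsilon> * (\<xi> \<bullet> \<xi>)) * b"
      using pos by (simp add: b_def)
    have "c * (b * cos (\<xi> \<bullet> x + \<theta>)) - \<epsilon> * laplacian (\<lambda>x. b * cos (\<xi> \<bullet> x + \<theta>)) x
        = a * cos (\<xi> \<bullet> x + \<theta>)" for x
      unfolding laplacian_mode b by (simp add: algebra_simps)
    then show ?case
      using trig_poly.mode[OF mode, of b \<theta>] by blast
  next
    case (add u v)
    then obtain \<psi>1 \<psi>2 where *: "trig_poly X \<psi>1" "trig_poly X \<psi>2"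
      "\<And>x. c * \<psi>1 x - \<epsilon> * laplacian \<psi>1 x = u x" "\<And>x. c * \<psi>2 x - \<epsilon> * laplacian \<psi>2 x = v x"
      by blast
    then have "c * (\<psi>1 x + \<psi>2 x) - \<epsilon> * laplacian (\<lambda>x. \<psi>1 x + \<psi>2 x) x = u x + v x" for x
      using *(3,4)[of x] by (simp add: laplacian_add[OF *(1,2)] algebra_simps)
    then show ?case using trig_poly.add[OF *(1,2)] by blast
  qed
  then show thesis using that by blast
qed

lemma second_deriv_nonneg_at_min:
  fixes g g' :: "real \<Rightarrow> real"
  assumes g: "\<And>t. (g has_real_derivative g' t) (at t)"
    and g': "(g' has_real_derivative l) (at 0)"
    and min: "\<And>t. g 0 \<le> g t"
  shows "0 \<le> l"
proof (rule ccontr)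
  assume "\<not> 0 \<le> l"
  then have "l < 0" by simp
  from DERIV_neg_dec_right[OF g' this] obtain d
    where d: "d > 0" "\<And>h. 0 < h \<Longrightarrow> h < d \<Longrightarrow> g' h < g' 0" by auto
  have "g' 0 = 0"
    using g[of 0] min by (intro DERIV_local_min[OF g[of 0], of 1]) auto
  have "g (d / 2) < g 0"
  proof (rule DERIV_neg_imp_decreasing_open[of 0 "d / 2" g])
    show "0 < d / 2" using d by simp
    show "\<exists>y. (g has_real_derivative y) (at t) \<and> y < 0" if "0 < t" "t < d / 2" for t
      using g[of t] d(2)[of t] that d(1) \<open>g' 0 = 0\<close> by auto
    show "continuous_on {0..d / 2} g"
      using g by (meson DERIV_continuous_on has_field_derivative_at_within)
  qed
  with min[of "d/2"] show False by simp
qed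

lemma has_real_derivative_along_axis:
  fixes u :: "real^'d \<Rightarrow> real"
  assumes "u differentiable (at (x + t *\<^sub>R axis i 1))"
  shows "((\<lambda>t. u (x + t *\<^sub>R axis i 1)) has_real_derivative partial_deriv i u (x + t *\<^sub>R axis i 1)) (at t)"
proof -
  let ?y = "x + t *\<^sub>R axis i 1"
  have D: "(u has_derivative frechet_derivative u (at ?y)) (at ?y)"
    using assms by (simp add: frechet_derivative_works[symmetric])
  have "((\<lambda>t. x + t *\<^sub>R axis i 1) has_derivative (\<lambda>h. h *\<^sub>R axis i 1)) (at t)"
    by (auto intro!: derivative_eq_intros)
  from has_derivative_compose[OF this D]
  show ?thesis
    unfolding has_field_derivative_def partial_deriv_def
    by (simp add: linear_scale[OF has_derivative_linear[OF D]] mult_commute_abs)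
qed

lemma laplacian_nonneg_at_min:
  assumes "trig_poly X u" and min: "\<And>y. u x \<le> u y"
  shows "0 \<le> laplacian u x"
  unfolding laplacian_def
proof (rule sum_nonneg)
  fix i
  show "0 \<le> partial_deriv i (partial_deriv i u) x"
  proof (rule second_deriv_nonneg_at_min)
    show "((\<lambda>t. u (x + t *\<^sub>R axis i 1)) has_real_derivative
        partial_deriv i u (x + t *\<^sub>R axis i 1)) (at t)" for t
      by (intro has_real_derivative_along_axis trig_poly_differentiable[OF assms(1)])
    show "((\<lambda>t. partial_deriv i u (x + t *\<^sub>R axis i 1)) has_real_derivative
        partial_deriv i (partial_deriv i u) x) (at 0)"
      using has_real_derivative_along_axis[of "partial_deriv i u" x 0 i]
        trig_poly_differentiable[OF trig_poly_partial_deriv[OF assms(1)]] by simp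
  qed (simp add: min)
qed

lemma trig_poly_attains_min:
  fixes X :: "real^'d"
  assumes "trig_poly X u" and box: "\<And>i. X $ i > 0"
  obtains x where "\<And>y. u x \<le> u y"
proof -
  have "0 \<in> cbox (- X) X"
    using box by (simp add: mem_box_cart less_imp_le)
  then obtain x where x: "\<And>y. y \<in> cbox (- X) X \<Longrightarrow> u x \<le> u y"
    using continuous_attains_inf[of "cbox (- X) X" u] trig_poly_continuous[OF assms(1)]
    by (metis compact_cbox empty_iff)
  have "u x \<le> u y" for y
  proof -
    define n where "n i = \<lfloor>(y $ i + X $ i) / (2 * X $ i)\<rfloor>" for i
    define z where "z = (\<chi> i. 2 * X $ i * of_int (- n i))"
    have "y + z \<in> cbox (- X) X"
      unfolding mem_box_cart
    proof
      fix i
      let ?r = "(y $ i + X $ i) / (2 * X $ i)"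
      have "of_int (n i) \<le> ?r" "?r \<le> of_int (n i) + 1"
        unfolding n_def by linarith+
      then show "(- X) $ i \<le> (y + z) $ i \<and> (y + z) $ i \<le> X $ i"
        using box[of i] by (simp add: z_def field_simps)
    qed
    moreover have "u (y + z) = u y"
      by (rule trig_poly_lattice_periodic[OF assms(1), where n="\<lambda>i. - n i"]) (simp add: z_def)
    ultimately show ?thesis using x[of "y + z"] by simp
  qed
  then show thesis using that by blast
qed

text \<open>
  At a global minimum of \<open>\<psi>\<close> the Laplacian is nonnegative, so \<open>c \<psi> \<ge> \<epsilon> \<Delta>\<psi> \<ge> 0\<close> there.
\<close>

lemma trig_poly_max_principle:
  fixes X :: "real^'d"
  assumes "trig_poly X \<psi>" and box: "\<And>i. X $ i > 0" and c: "c > 0" and \<epsilon>: "\<epsilon> > 0"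
    and nonneg: "\<And>x. 0 \<le> c * \<psi> x - \<epsilon> * laplacian \<psi> x"
  shows "0 \<le> \<psi> x"
proof -
  obtain y where y: "\<And>z. \<psi> y \<le> \<psi> z"
    using trig_poly_attains_min[OF assms(1) box] by blast
  have "0 \<le> \<epsilon> * laplacian \<psi> y"
    using laplacian_nonneg_at_min[OF assms(1) y] \<epsilon> by simp
  with nonneg[of y] have "0 \<le> c * \<psi> y" by linarith
  then have "0 \<le> \<psi> y" using c by (simp add: zero_le_mult_iff)
  with y[of x] show ?thesis by simp
qed

section \<open>Integrals over the period cell\<close>

text \<open>
  Shifting by \<open>s\<close> in direction \<open>i\<close> moves the slab \<open>x\<^sub>i > X\<^sub>i - s\<close> out of the cell; shifted back by one
  period it fills the gap left at the opposite face.
\<close>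

lemma integral_periodic_shift:
  fixes X :: "real^'d" and g :: "real^'d \<Rightarrow> real"
  assumes cont: "continuous_on UNIV g"
    and per: "\<And>x. g (x + axis i (2 * X $ i)) = g x"
    and s: "0 \<le> s" "s \<le> 2 * X $ i"
  shows "integral (cbox (- X) X) (\<lambda>x. g (x + axis i s)) = integral (cbox (- X) X) g"
proof -
  let ?a = "axis i s" and ?p = "axis i (2 * X $ i)" and ?k = "axis i (1::real)"
  have int: "g integrable_on cbox a b" for a b
    using cont by (intro integrable_continuous) (rule continuous_on_subset, auto)
  have k: "?k \<in> Basis" by simp
  have shift: "integral (cbox a b) (\<lambda>x. g (x + z)) = integral (cbox (a + z) (b + z)) g" for a b z
    using integral_shift_cbox_plus[of a b g z] by (simp add: o_def add.commute)
  have cbox_iff: "x \<in> cbox a b \<longleftrightarrow>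
      a $ i \<le> x $ i \<and> x $ i \<le> b $ i \<and> (\<forall>j. j \<noteq> i \<longrightarrow> a $ j \<le> x $ j \<and> x $ j \<le> b $ j)" for x a b :: "real^'d"
    unfolding mem_box_cart by metis
  have "integral (cbox (- X) X) (\<lambda>x. g (x + ?a)) = integral (cbox (- X + ?a) (X + ?a)) g"
    by (rule shift)
  also have "\<dots> = integral (cbox (- X + ?a) (X + ?a) \<inter> {x. x \<bullet> ?k \<le> X $ i}) g
      + integral (cbox (- X + ?a) (X + ?a) \<inter> {x. x \<bullet> ?k \<ge> X $ i}) g"
    by (rule integral_split[OF int k])
  also have "cbox (- X + ?a) (X + ?a) \<inter> {x. x \<bullet> ?k \<le> X $ i} = cbox (- X + ?a) X"
    using s by (auto simp: cbox_iff inner_axis) (auto simp: axis_def)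
  also have "cbox (- X + ?a) (X + ?a) \<inter> {x. x \<bullet> ?k \<ge> X $ i} = cbox (- X + ?p) (X + (?a - ?p) + ?p)"
    using s by (auto simp: cbox_iff inner_axis) (auto simp: axis_def)
  also have "integral (cbox (- X + ?p) (X + (?a - ?p) + ?p)) g = integral (cbox (- X) (X + (?a - ?p))) g"
    by (simp only: shift[symmetric] per)
  also have "cbox (- X) (X + (?a - ?p)) = cbox (- X) X \<inter> {x. x \<bullet> ?k \<le> s - X $ i}"
    using s by (auto simp: cbox_iff inner_axis) (auto simp: axis_def)
  also have "cbox (- X + ?a) X = cbox (- X) X \<inter> {x. x \<bullet> ?k \<ge> s - X $ i}"
    using s by (auto simp: cbox_iff inner_axis) (auto simp: axis_def)
  also have "integral (cbox (- X) X \<inter> {x. x \<bullet> ?k \<ge> s - X $ i}) g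
      + integral (cbox (- X) X \<inter> {x. x \<bullet> ?k \<le> s - X $ i}) g = integral (cbox (- X) X) g"
    using integral_split[OF int k, of "- X" X "s - X $ i"] by simp
  finally show ?thesis .
qed

text \<open>
  A shift by half a wavelength in a direction with \<open>\<xi>\<^sub>i \<noteq> 0\<close> changes the sign of the mode but not
  its integral.
\<close>

lemma integral_mode_eq_0:
  fixes X :: "real^'d"
  assumes box: "\<And>i. X $ i > 0" and \<xi>: "\<And>i. \<xi> $ i * X $ i / pi \<in> \<int>" and "\<xi> \<noteq> 0"
  shows "integral (cbox (- X) X) (\<lambda>x. a * cos (\<xi> \<bullet> x + \<theta>)) = 0"
proof -
  let ?g = "\<lambda>x. a * cos (\<xi> \<bullet> x + \<theta>)"
  obtain i where i: "\<xi> $ i \<noteq> 0"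
    using \<open>\<xi> \<noteq> 0\<close> by (auto simp: vec_eq_iff)
  have tp: "trig_poly X ?g" using \<xi> by (rule trig_poly.mode)
  define s where "s = pi / \<bar>\<xi> $ i\<bar>"
  \<comment> \<open>A nonzero integer has modulus at least 1, so half a wavelength fits into the cell.\<close>
  have "1 \<le> \<bar>\<xi> $ i * X $ i / pi\<bar>"
    using \<xi>[of i] i box[of i] by (intro Ints_nonzero_abs_ge1) auto
  then have "s \<le> X $ i"
    using box[of i] i by (simp add: s_def abs_mult field_simps)
  then have s: "0 \<le> s" "s \<le> 2 * X $ i"
    using box[of i] by (auto simp: s_def)
  have "?g (x + axis i s) = - ?g x" for x
  proof -
    have "\<xi> $ i * s = pi \<or> \<xi> $ i * s = - pi"
      using i by (cases "\<xi> $ i > 0") (auto simp: s_def)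
    moreover have "\<xi> \<bullet> (x + axis i s) + \<theta> = (\<xi> \<bullet> x + \<theta>) + \<xi> $ i * s"
      by (simp add: inner_add_right inner_axis)
    ultimately have "cos (\<xi> \<bullet> (x + axis i s) + \<theta>) = - cos (\<xi> \<bullet> x + \<theta>)"
      by (auto simp only: cos_add[of "\<xi> \<bullet> x + \<theta>"]) simp_all
    then show ?thesis by simp
  qed
  then have "(\<lambda>x. ?g (x + axis i s)) = (\<lambda>x. - ?g x)" by (rule ext)
  moreover have "integral (cbox (- X) X) (\<lambda>x. ?g (x + axis i s)) = integral (cbox (- X) X) ?g"
    by (rule integral_periodic_shift[OF trig_poly_continuous[OF tp] _ s])
      (use trig_poly_periodic[OF tp] in \<open>simp only: periodic_def\<close>)
  ultimately have "- integral (cbox (- X) X) ?g = integral (cbox (- X) X) ?g"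
    by (simp only: integral_neg)
  then show ?thesis by linarith
qed

lemma integrable_torus_continuous:
  fixes f :: "real^'d \<Rightarrow> real"
  assumes "continuous_on UNIV f"
  shows "integrable (torus X) f"
  unfolding torus_def
  by (rule continuous_imp_integrable, rule continuous_on_subset[OF assms]) simp

lemma integrable_torus_mult_continuous:
  fixes f :: "real^'d \<Rightarrow> real"
  assumes q: "integrable (torus X) q" and f: "continuous_on UNIV f"
  shows "integrable (torus X) (\<lambda>x. q x * f x)"
proof -
  have "compact (f ` cbox (- X) X)"
    by (intro compact_continuous_image continuous_on_subset[OF f]) auto
  then obtain B where B: "\<And>x. x \<in> cbox (- X) X \<Longrightarrow> \<bar>f x\<bar> \<le> B"
    using compact_imp_bounded bounded_iff by (metis image_eqI real_norm_def)
  have sp: "space (torus X) = cbox (- X) X" by (simp add: torus_def)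
  show ?thesis
  proof (rule Bochner_Integration.integrable_bound)
    show "integrable (torus X) (\<lambda>x. B * q x)" using q by simp
    show "(\<lambda>x. q x * f x) \<in> borel_measurable (torus X)"
      using q integrable_torus_continuous[OF f]
      by (intro borel_measurable_times borel_measurable_integrable)
    show "AE x in torus X. norm (q x * f x) \<le> norm (B * q x)"
    proof (rule AE_I2)
      fix x assume "x \<in> space (torus X)"
      then have "\<bar>f x\<bar> \<le> \<bar>B\<bar>" using B[of x] sp by auto
      then show "norm (q x * f x) \<le> norm (B * q x)"
        by (simp add: abs_mult mult.commute mult_right_mono)
    qed
  qed
qed

text \<open>
  Equivalently, the constant function 1 has weak Laplacian 0, as far as trigonometric
  polynomials can test this.
\<close>

lemma integral_laplacian_eq_0:
  fixes X :: "real^'d"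
  assumes "trig_poly X u" and box: "\<And>i. X $ i > 0"
  shows "(LINT x|torus X. laplacian u x) = 0"
  using assms(1)
proof induction
  case (mode \<xi> a \<theta>)
  have tp: "trig_poly X (\<lambda>x. a * cos (\<xi> \<bullet> x + \<theta>))" using mode by (rule trig_poly.mode)
  show ?case
  proof (cases "\<xi> = 0")
    case False
    have "(LINT x|torus X. a * cos (\<xi> \<bullet> x + \<theta>)) = integral (cbox (- X) X) (\<lambda>x. a * cos (\<xi> \<bullet> x + \<theta>))"
      using integrable_torus_continuous[OF trig_poly_continuous[OF tp]]
      unfolding torus_def by (intro lebesgue_integral_eq_integral) auto
    then show ?thesis
      using integral_mode_eq_0[OF box mode False] by (simp only: laplacian_mode) simp
  qed (simp only: laplacian_mode, simp)
next
  case (add u v)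
  have "integrable (torus X) (laplacian u)" "integrable (torus X) (laplacian v)"
    using add.hyps by (auto intro!: integrable_torus_continuous trig_poly_continuous trig_poly_laplacian)
  then show ?case
    using add by (simp add: laplacian_add[OF add.hyps])
qed

section \<open>Density of trigonometric polynomials\<close>

text \<open>
  The embedding of the torus into Euclidean space by the cosines and sines of the coordinate
  angles \<open>\<pi> x\<^sub>i / X\<^sub>i\<close>. Real polynomials on the target pull back to trigonometric polynomials, and
  by the Stone-Weierstrass theorem they are uniformly dense in the continuous functions on any
  compact set containing the image.
\<close>

definition torus_embed :: "real^'d \<Rightarrow> real^'d \<Rightarrow> (real^'d) \<times> (real^'d)" where
  "torus_embed X x = ((\<chi> i. cos (pi * x $ i / X $ i)), (\<chi> i. sin (pi * x $ i / X $ i)))"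

lemma trig_poly_coordinate:
  fixes X :: "real^'d"
  assumes "\<And>i. X $ i > 0"
  shows "trig_poly X (\<lambda>x. cos (pi * x $ i / X $ i))" "trig_poly X (\<lambda>x. sin (pi * x $ i / X $ i))"
proof -
  have *: "axis i (pi / X $ i) $ j * X $ j / pi \<in> \<int>" for j
    using assms[of i] by (auto simp: axis_def)
  have e: "axis i (pi / X $ i) \<bullet> x = pi * x $ i / X $ i" for x
    by (simp add: inner_axis inner_commute)
  show "trig_poly X (\<lambda>x. cos (pi * x $ i / X $ i))"
    using trig_poly.mode[OF *, of 1 0] by (simp add: e)
  show "trig_poly X (\<lambda>x. sin (pi * x $ i / X $ i))"
    using trig_poly.mode[OF *, of 1 "- (pi / 2)"] by (simp add: e cos_diff)
qed

lemma trig_poly_polynomial: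
  fixes X :: "real^'d"
  assumes "real_polynomial_function p" and box: "\<And>i. X $ i > 0"
  shows "trig_poly X (\<lambda>x. p (torus_embed X x))"
  using assms(1)
proof induction
  case (linear f)
  then have f: "linear f" by (rule bounded_linear.linear)
  have "f (torus_embed X x) = (\<Sum>i\<in>UNIV. f (axis i 1, 0) * cos (pi * x $ i / X $ i))
      + (\<Sum>i\<in>UNIV. f (0, axis i 1) * sin (pi * x $ i / X $ i))" for x
  proof -
    let ?c = "\<lambda>i. cos (pi * x $ i / X $ i)" and ?s = "\<lambda>i. sin (pi * x $ i / X $ i)"
    have "torus_embed X x = (\<Sum>i\<in>UNIV. ?c i *\<^sub>R (axis i 1, 0)) + (\<Sum>i\<in>UNIV. ?s i *\<^sub>R (0, axis i 1))"
      by (simp add: torus_embed_def prod_eq_iff fst_sum snd_sum vec_eq_iff axis_def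
          if_distrib sum.delta cong: if_cong)
    then have "f (torus_embed X x) =
        f (\<Sum>i\<in>UNIV. ?c i *\<^sub>R (axis i 1, 0)) + f (\<Sum>i\<in>UNIV. ?s i *\<^sub>R (0, axis i 1))"
      by (simp only: linear_add[OF f])
    also have "f (\<Sum>i\<in>UNIV. ?c i *\<^sub>R (axis i 1, 0)) = (\<Sum>i\<in>UNIV. f (axis i 1, 0) * ?c i)"
      by (simp only: linear_sum[OF f] linear_scale[OF f] real_scaleR_def mult.commute)
    also have "f (\<Sum>i\<in>UNIV. ?s i *\<^sub>R (0, axis i 1)) = (\<Sum>i\<in>UNIV. f (0, axis i 1) * ?s i)"
      by (simp only: linear_sum[OF f] linear_scale[OF f] real_scaleR_def mult.commute)
    finally show ?thesis .
  qed
  moreover have "trig_poly X (\<lambda>x. (\<Sum>i\<in>UNIV. f (axis i 1, 0) * cos (pi * x $ i / X $ i))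
      + (\<Sum>i\<in>UNIV. f (0, axis i 1) * sin (pi * x $ i / X $ i)))"
    by (intro trig_poly.add trig_poly_sum trig_poly_cmult trig_poly_coordinate box)
  ultimately show ?case by presburger
qed (auto intro: trig_poly_const trig_poly.add trig_poly_mult)

lemma continuous_torus_embed: "continuous_on UNIV (torus_embed X)"
proof -
  have "torus_embed X = (\<lambda>x. ((\<chi> i. cos (pi / X $ i * x $ i)), (\<chi> i. sin (pi / X $ i * x $ i))))"
    by (simp add: torus_embed_def fun_eq_iff)
  moreover have "continuous_on UNIV (\<lambda>x. ((\<chi> i. cos (pi / X $ i * x $ i)), (\<chi> i. sin (pi / X $ i * x $ i))))"
    by (intro continuous_on_Pair continuous_on_vec_lambda continuous_on_cos continuous_on_sin
        continuous_on_mult_left continuous_on_component continuous_on_id)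
  ultimately show ?thesis by simp
qed

text \<open>
  Injectivity fails on the closed cell, whose opposite faces are identified; it suffices that one
  of the two points is interior.
\<close>

lemma torus_embed_inj:
  fixes X :: "real^'d"
  assumes x: "x \<in> box (- X) X" and y: "y \<in> cbox (- X) X"
    and eq: "torus_embed X x = torus_embed X y"
  shows "x = y"
proof -
  have "x $ i = y $ i" for i
  proof -
    have bx: "- X $ i < x $ i" "x $ i < X $ i" using x by (auto simp: mem_box_cart)
    have by': "- X $ i \<le> y $ i" "y $ i \<le> X $ i" using y by (auto simp: mem_box_cart)
    have X: "X $ i > 0" using bx by linarith
    have "cos (pi * x $ i / X $ i) = cos (pi * y $ i / X $ i)"
      "sin (pi * x $ i / X $ i) = sin (pi * y $ i / X $ i)"
      using eq by (auto simp: torus_embed_def vec_eq_iff)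
    then obtain n :: int where "pi * x $ i / X $ i = pi * y $ i / X $ i + 2 * pi * n"
      using sin_cos_eq_iff[of "pi * x $ i / X $ i" "pi * y $ i / X $ i"] by auto
    then have "pi * x $ i = pi * (y $ i + 2 * n * X $ i)"
      using X by (simp add: field_simps)
    then have n: "x $ i = y $ i + 2 * n * X $ i" by simp
    then have "\<bar>2 * n * X $ i\<bar> < 2 * X $ i"
      using bx by' by linarith
    then have "\<bar>real_of_int n\<bar> < 1"
      using X by (simp add: abs_mult)
    then have "n = 0" by linarith
    with n show ?thesis by simp
  qed
  then show ?thesis by (simp add: vec_eq_iff)
qed

text \<open>
  The Stone-Weierstrass theorem extends nonnegativity of the integrals from trigonometric
  polynomials to all nonnegative continuous functions on the embedded torus.
\<close>

lemma integral_continuous_on_torus_nonneg: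
  fixes X :: "real^'d"
  assumes box: "\<And>i. X $ i > 0" and q: "integrable (torus X) q"
    and nonneg: "\<And>\<eta>. trig_poly X \<eta> \<Longrightarrow> (\<And>x. 0 \<le> \<eta> x) \<Longrightarrow> 0 \<le> (LINT x|torus X. q x * \<eta> x)"
    and F: "continuous_on UNIV F" "\<And>y. 0 \<le> F y"
  shows "0 \<le> (LINT x|torus X. q x * F (torus_embed X x))"
proof (rule ccontr)
  define J where "J = (LINT x|torus X. q x * F (torus_embed X x))"
  define Q where "Q = (LINT x|torus X. \<bar>q x\<bar>)"
  assume "\<not> 0 \<le> (LINT x|torus X. q x * F (torus_embed X x))"
  then have J: "J < 0" by (simp add: J_def)
  have Q: "0 \<le> Q" by (simp add: Q_def)
  \<comment> \<open>Chosen such that \<open>J + 2 e (Q + 1) = 0\<close>; the summand 1 covers the case \<open>Q = 0\<close>.\<close>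
  define e where "e = - J / (2 * (Q + 1))"
  have e: "e > 0" unfolding e_def using J Q by (intro divide_pos_pos) auto
  let ?S = "cbox (\<chi> i. - 1) (\<chi> i. 1) \<times> cbox (\<chi> i. - 1) (\<chi> i. 1)"
  have S: "torus_embed X x \<in> ?S" for x
    by (simp add: torus_embed_def mem_box_cart)
  have "compact ?S" by (intro compact_Times compact_cbox)
  then obtain p where p: "real_polynomial_function p" "\<And>y. y \<in> ?S \<Longrightarrow> \<bar>F y - p y\<bar> < e"
    using Stone_Weierstrass_real_polynomial_function[of ?S F e] F(1) e continuous_on_subset by blast
  \<comment> \<open>Adding \<open>e\<close> makes the approximation nonnegative.\<close>
  define \<eta> where "\<eta> x = p (torus_embed X x) + e" for x
  have \<eta>: "trig_poly X \<eta>"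
    unfolding \<eta>_def[abs_def] by (intro trig_poly.add trig_poly_const trig_poly_polynomial p box)
  have close: "0 \<le> \<eta> x" "\<bar>F (torus_embed X x) - \<eta> x\<bar> \<le> 2 * e" for x
    using p(2)[OF S[of x]] F(2)[of "torus_embed X x"] unfolding \<eta>_def by linarith+
  have int: "integrable (torus X) (\<lambda>x. q x * F (torus_embed X x))"
    by (intro integrable_torus_mult_continuous q
        continuous_on_compose2[OF F(1) continuous_torus_embed]) simp
  have "0 \<le> (LINT x|torus X. q x * \<eta> x)"
    using \<eta> close(1) by (rule nonneg)
  also have "\<dots> \<le> (LINT x|torus X. q x * F (torus_embed X x) + 2 * e * \<bar>q x\<bar>)"
  proof (rule integral_mono)
    show "integrable (torus X) (\<lambda>x. q x * \<eta> x)"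
      by (intro integrable_torus_mult_continuous q trig_poly_continuous[OF \<eta>])
    show "integrable (torus X) (\<lambda>x. q x * F (torus_embed X x) + 2 * e * \<bar>q x\<bar>)"
      using int q by simp
    fix x
    have "q x * (\<eta> x - F (torus_embed X x)) \<le> \<bar>q x\<bar> * \<bar>\<eta> x - F (torus_embed X x)\<bar>"
      by (metis abs_ge_self abs_mult)
    also have "\<dots> \<le> \<bar>q x\<bar> * (2 * e)"
      using close(2)[of x] by (intro mult_left_mono) auto
    finally show "q x * \<eta> x \<le> q x * F (torus_embed X x) + 2 * e * \<bar>q x\<bar>"
      by (simp add: algebra_simps)
  qed
  also have "\<dots> = J + 2 * e * Q"
    unfolding J_def Q_def using int q by simp
  also have "\<dots> < J + 2 * e * (Q + 1)"
    using e by simp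
  also have "\<dots> = 0"
  proof -
    have "2 * (Q + 1) \<noteq> 0" using Q by auto
    then have "e * (2 * (Q + 1)) = - J" unfolding e_def by (rule nonzero_eq_divide_eq[THEN iffD1]) simp
    then show ?thesis by (simp add: algebra_simps)
  qed
  finally show False by simp
qed

text \<open>
  The indicator of \<open>K\<close> is the pointwise limit on the cell of the continuous functions
  \<open>max 0 (1 - n dist (E x, E K))\<close>, where \<open>E\<close> is the embedding. As \<open>K\<close> is interior to the cell,
  \<open>E\<close> maps no other point of the closed cell into \<open>E K\<close>.
\<close>

lemma integral_compact_nonneg:
  fixes X :: "real^'d"
  assumes box: "\<And>i. X $ i > 0" and q: "integrable (torus X) q"
    and nonneg: "\<And>\<eta>. trig_poly X \<eta> \<Longrightarrow> (\<And>x. 0 \<le> \<eta> x) \<Longrightarrow> 0 \<le> (LINT x|torus X. q x * \<eta> x)"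
    and K: "compact K" "K \<subseteq> box (- X) X"
  shows "0 \<le> (LINT x|torus X. q x * indicator K x)"
proof (cases "K = {}")
  case False
  let ?E = "torus_embed X"
  define F where "F n y = max 0 (1 - real n * infdist y (?E ` K))" for n y
  have F: "continuous_on UNIV (F n)" "0 \<le> F n y" "F n y \<le> 1" for n y
    unfolding F_def by (auto intro!: continuous_intros simp: infdist_nonneg)
  have FE: "continuous_on UNIV (\<lambda>x. F n (?E x))" for n
    by (rule continuous_on_compose2[OF F(1) continuous_torus_embed]) auto
  have EK: "closed (?E ` K)" "?E ` K \<noteq> {}"
    using False by (auto intro!: compact_imp_closed compact_continuous_image K
        continuous_on_subset[OF continuous_torus_embed])
  have lim: "(\<lambda>n. F n (?E x)) \<longlonglongrightarrow> indicator K x" if x: "x \<in> cbox (- X) X" for x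
  proof (cases "x \<in> K")
    case True
    then show ?thesis by (simp add: F_def)
  next
    case False
    have "?E x \<notin> ?E ` K"
    proof
      assume "?E x \<in> ?E ` K"
      then obtain y where y: "y \<in> K" "?E x = ?E y" by (elim imageE)
      then have "y \<in> box (- X) X" using K(2) by (elim subsetD)
      from torus_embed_inj[OF this x y(2)[symmetric]] y(1) False show False by simp
    qed
    then have "infdist (?E x) (?E ` K) \<noteq> 0"
      by (simp only: in_closed_iff_infdist_zero[OF EK] not_False_eq_True)
    then have d: "infdist (?E x) (?E ` K) > 0"
      using infdist_nonneg[of "?E x" "?E ` K"] by linarith
    obtain N where N: "1 < real N * infdist (?E x) (?E ` K)"
      using reals_Archimedean3[OF d] by blast
    have "F n (?E x) = 0" if "n \<ge> N" for n
    proof -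
      have "real N * infdist (?E x) (?E ` K) \<le> real n * infdist (?E x) (?E ` K)"
        using that d by simp
      with N show ?thesis by (simp add: F_def)
    qed
    then have "\<forall>\<^sub>F n in sequentially. F n (?E x) = indicator K x"
      using False eventually_sequentially by force
    then show ?thesis by (rule tendsto_eventually)
  qed
  have "(\<lambda>n. LINT x|torus X. q x * F n (?E x)) \<longlonglongrightarrow> (LINT x|torus X. q x * indicator K x)"
  proof (rule integral_dominated_convergence)
    show "integrable (torus X) (\<lambda>x. \<bar>q x\<bar>)" using q by simp
    show "(\<lambda>x. q x * F n (?E x)) \<in> borel_measurable (torus X)" for n
      by (intro borel_measurable_integrable integrable_torus_mult_continuous q FE)
    have "K \<in> sets (torus X)"
      unfolding torus_def using K box_subset_cbox[of "- X" X]
      by (auto simp: sets_restrict_space_iff intro!: borel_compact sets_completionI_sets)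
    then show "(\<lambda>x. q x * indicator K x) \<in> borel_measurable (torus X)"
      using borel_measurable_integrable[OF q] by simp
    show "AE x in torus X. (\<lambda>n. q x * F n (?E x)) \<longlonglongrightarrow> q x * indicator K x"
      using lim by (intro AE_I2 tendsto_mult_left) (simp add: torus_def)
    show "AE x in torus X. norm (q x * F n (?E x)) \<le> \<bar>q x\<bar>" for n
      using F(2,3) by (intro AE_I2) (simp add: abs_mult mult_left_le)
  qed
  moreover have "0 \<le> (LINT x|torus X. q x * F n (?E x))" for n
    using box q nonneg F(1,2) by (rule integral_continuous_on_torus_nonneg)
  ultimately show ?thesis
    by (intro LIMSEQ_le_const) auto
qed simp

text \<open>
  By inner regularity it is enough that every closed subset \<open>T\<close> of \<open>{q < 0}\<close> in the open cell is
  null, and this holds because the integral of \<open>q\<close> over the compact set \<open>T\<close> is nonnegative.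
\<close>

lemma AE_nonneg_if_trig_poly_integrals_nonneg:
  fixes X :: "real^'d"
  assumes box: "\<And>i. X $ i > 0" and q: "integrable (torus X) q"
    and nonneg: "\<And>\<eta>. trig_poly X \<eta> \<Longrightarrow> (\<And>x. 0 \<le> \<eta> x) \<Longrightarrow> 0 \<le> (LINT x|torus X. q x * \<eta> x)"
  shows "AE x in torus X. 0 \<le> q x"
proof -
  let ?C = "cbox (- X) X"
  define N where "N = {x \<in> box (- X) X. q x < 0}"
  have "{x \<in> ?C. q x < 0} \<in> sets (torus X)"
    using borel_measurable_integrable[OF q] by (simp add: borel_measurable_iff_less torus_def)
  then have "{x \<in> ?C. q x < 0} \<in> sets lebesgue"
    by (simp add: torus_def sets_restrict_space_iff)
  then have "{x \<in> ?C. q x < 0} \<inter> box (- X) X \<in> sets lebesgue"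
    by (intro sets.Int) auto
  also have "{x \<in> ?C. q x < 0} \<inter> box (- X) X = N"
    using box_subset_cbox[of "- X" X] by (auto simp: N_def)
  finally have N: "N \<in> sets lebesgue" .
  have null: "emeasure lebesgue T = 0" if T: "closed T" "T \<subseteq> N" for T
  proof -
    have sub: "T \<subseteq> box (- X) X" "T \<subseteq> ?C"
      using T(2) box_subset_cbox[of "- X" X] by (auto simp: N_def)
    have "compact T"
      using T(1) sub(1) bounded_subset[OF bounded_box] by (auto simp: compact_eq_bounded_closed)
    from box q nonneg this sub(1) have ge: "0 \<le> (LINT x|torus X. q x * indicator T x)"
      by (rule integral_compact_nonneg)
    have Ts: "T \<in> sets (torus X)"
      unfolding torus_def using T(1) sub(2) by (auto simp: sets_restrict_space_iff)
    have int: "integrable (torus X) (\<lambda>x. - (q x * indicator T x))"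
      using integrable_real_mult_indicator[OF Ts q] by simp
    have pos: "0 \<le> - (q x * indicator T x)" for x
      using T(2) by (auto simp: N_def indicator_def)
    have "(LINT x|torus X. - (q x * indicator T x)) = 0"
      using ge Bochner_Integration.integral_nonneg[of "torus X" "\<lambda>x. - (q x * indicator T x)"] pos by simp
    then have "AE x in torus X. - (q x * indicator T x) = 0"
      using integral_nonneg_eq_0_iff_AE[OF int] pos by blast
    then have "AE x in lebesgue. x \<in> ?C \<longrightarrow> q x * indicator T x = 0"
      unfolding torus_def by (subst (asm) AE_restrict_space_iff) auto
    then have "AE x in lebesgue. x \<notin> T"
      by eventually_elim (use T(2) sub(2) in \<open>auto simp: N_def indicator_def\<close>)
    moreover have "T \<in> sets lebesgue"
      using T(1) by (intro sets_completionI_sets) simp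
    ultimately show ?thesis
      using AE_iff_measurable[of T lebesgue "\<lambda>x. x \<notin> T"] by simp
  qed
  have "emeasure lebesgue N \<le> ennreal e" if e: "e > 0" for e
  proof -
    obtain T where T: "closed T" "T \<subseteq> N" "N - T \<in> lmeasurable" "emeasure lebesgue (N - T) < ennreal e"
      using sets_lebesgue_inner_closed[OF N e] by blast
    have "emeasure lebesgue N = emeasure lebesgue (T \<union> (N - T))"
      using T(2) by (simp add: Un_absorb1)
    also have "\<dots> \<le> emeasure lebesgue T + emeasure lebesgue (N - T)"
      using T N by (intro emeasure_subadditive) auto
    also have "\<dots> \<le> ennreal e"
      using null[OF T(1,2)] T(4) by simp
    finally show ?thesis .
  qed
  then have "emeasure lebesgue N = 0"
    by (metis ennreal_le_epsilon add_0 le_zero_eq zero_le)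
  then have "negligible N"
    using N by (simp add: negligible_iff_null_sets null_sets_def)
  moreover have "negligible (?C - box (- X) X)" 
    by (rule negligible_frontier_interval)
  ultimately have "negligible (N \<union> (?C - box (- X) X))" by simp
  then have "AE x in lebesgue. x \<notin> N \<union> (?C - box (- X) X)"
    by (simp only: negligible_iff_null_sets AE_not_in)
  then have "AE x in lebesgue. x \<in> ?C \<longrightarrow> 0 \<le> q x"
    by eventually_elim (auto simp: N_def)
  then show ?thesis
    unfolding torus_def by (subst AE_restrict_space_iff) auto
qed

section \<open>The weak maximum principle\<close>

text \<open>
  The maximum principle for integrable functions, by duality: for a trigonometric polynomial
  \<open>\<eta> \<ge> 0\<close>, the solution \<open>\<psi> \<ge> 0\<close> of \<open>c \<psi> - \<epsilon> \<Delta>\<psi> = \<eta>\<close> is an admissible test function and gives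
  \<open>\<integral> q \<eta> = \<integral> (c q - \<epsilon> w) \<psi> \<ge> 0\<close>. No regularity of
  \<open>q\<close> beyond integrability is needed.
\<close>

lemma weak_maximum_principle:
  fixes X :: "real^'d"
  assumes box: "\<And>i. X $ i > 0" and c: "c > 0" and \<epsilon>: "\<epsilon> > 0"
    and q: "integrable (torus X) q" and w: "integrable (torus X) w"
    and weak: "\<And>\<psi>. trig_poly X \<psi> \<Longrightarrow>
      (LINT x|torus X. q x * laplacian \<psi> x) = (LINT x|torus X. w x * \<psi> x)"
    and nonneg: "AE x in torus X. 0 \<le> c * q x - \<epsilon> * w x"
  shows "AE x in torus X. 0 \<le> q x"
proof (rule AE_nonneg_if_trig_poly_integrals_nonneg[OF box q])
  fix \<eta> assume \<eta>: "trig_poly X \<eta>" "\<And>x. 0 \<le> \<eta> x"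
  obtain \<psi> where \<psi>: "trig_poly X \<psi>" "\<And>x. c * \<psi> x - \<epsilon> * laplacian \<psi> x = \<eta> x"
    using trig_poly_resolvent[OF \<eta>(1) c \<epsilon>] by blast
  have pos: "0 \<le> \<psi> x" for x
    using trig_poly_max_principle[OF \<psi>(1) box c \<epsilon>] \<eta>(2) \<psi>(2) by simp
  have int: "integrable (torus X) (\<lambda>x. q x * \<psi> x)" "integrable (torus X) (\<lambda>x. w x * \<psi> x)"
    "integrable (torus X) (\<lambda>x. q x * laplacian \<psi> x)"
    by (intro integrable_torus_mult_continuous q w trig_poly_continuous[OF \<psi>(1)]
        trig_poly_continuous[OF trig_poly_laplacian[OF \<psi>(1)]])+
  have "(LINT x|torus X. q x * \<eta> x) = (LINT x|torus X. c * (q x * \<psi> x) - \<epsilon> * (q x * laplacian \<psi> x))"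
    by (simp add: \<psi>(2)[symmetric] algebra_simps)
  also have "\<dots> = c * (LINT x|torus X. q x * \<psi> x) - \<epsilon> * (LINT x|torus X. w x * \<psi> x)"
    using int by (simp add: weak[OF \<psi>(1)])
  also have "\<dots> = (LINT x|torus X. c * (q x * \<psi> x) - \<epsilon> * (w x * \<psi> x))"
    using int by simp
  also have "\<dots> = (LINT x|torus X. (c * q x - \<epsilon> * w x) * \<psi> x)"
    by (simp add: algebra_simps)
  also have "\<dots> \<ge> 0"
    using nonneg pos by (intro integral_nonneg_AE) (auto elim!: eventually_mono)
  finally show "0 \<le> (LINT x|torus X. q x * \<eta> x)" .
qed

text \<open>
  The lower bound is the maximum principle for \<open>q\<close>; the upper bound is the maximum principle for
  \<open>1 - q\<close>, whose weak Laplacian is \<open>- w\<close>.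
\<close>

lemma weak_comparison:
  fixes X :: "real^'d"
  assumes box: "\<And>i. X $ i > 0" and c: "c > 0" and \<epsilon>: "\<epsilon> > 0"
    and weak: "weak_laplacian X q w"
    and bounds: "AE x in torus X. 0 \<le> c * q x - \<epsilon> * w x \<and> c * q x - \<epsilon> * w x \<le> c"
  shows "AE x in torus X. 0 \<le> q x \<and> q x \<le> 1"
proof -
  have q: "integrable (torus X) q" and w: "integrable (torus X) w"
    and qw: "\<And>\<psi>. trig_poly X \<psi> \<Longrightarrow>
      (LINT x|torus X. q x * laplacian \<psi> x) = (LINT x|torus X. w x * \<psi> x)"
    using weak trig_poly_test_function by (auto simp: weak_laplacian_def)
  have "AE x in torus X. 0 \<le> q x"
    using bounds by (intro weak_maximum_principle[OF box c \<epsilon> q w qw]) (auto elim!: eventually_mono)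
  moreover have "AE x in torus X. 0 \<le> 1 - q x"
  proof (rule weak_maximum_principle[OF box c \<epsilon>, where w = "\<lambda>x. - w x"])
    show "integrable (torus X) (\<lambda>x. 1 - q x)"
      using q integrable_torus_continuous[of "\<lambda>x. 1" X] by simp
    show "integrable (torus X) (\<lambda>x. - w x)" using w by simp
    show "AE x in torus X. 0 \<le> c * (1 - q x) - \<epsilon> * - w x"
      using bounds by (auto elim!: eventually_mono simp: algebra_simps)
    fix \<psi> assume \<psi>: "trig_poly X \<psi>"
    have cont: "continuous_on UNIV (laplacian \<psi>)"
      by (intro trig_poly_continuous[OF trig_poly_laplacian[OF \<psi>]])
    have "(LINT x|torus X. (1 - q x) * laplacian \<psi> x) = (LINT x|torus X. laplacian \<psi> x - q x * laplacian \<psi> x)"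
      by (simp add: algebra_simps)
    also have "\<dots> = - (LINT x|torus X. q x * laplacian \<psi> x)"
      using integrable_torus_continuous[OF cont] integrable_torus_mult_continuous[OF q cont]
      by (simp add: integral_laplacian_eq_0[OF \<psi> box])
    finally show "(LINT x|torus X. (1 - q x) * laplacian \<psi> x) = (LINT x|torus X. - w x * \<psi> x)"
      by (simp add: qw[OF \<psi>])
  qed
  ultimately show ?thesis by eventually_elim simp
qed

section \<open>Pointwise bounds for the explicit terms\<close>

lemma deriv_W_pot: "deriv W_pot s = 36 * s * (1 - s) * (1 - 2 * s)"
proof -
  have "(W_pot has_real_derivative 36 * s * (1 - s) * (1 - 2 * s)) (at s)"
    unfolding W_pot_def[abs_def]
    by (auto intro!: derivative_eq_intros simp: algebra_simps power2_eq_square)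
  then show ?thesis by (rule DERIV_imp_deriv)
qed

lemma deriv2_W_pot: "deriv (deriv W_pot) s = 36 * (6 * s\<^sup>2 - 6 * s + 1)"
proof -
  have "((\<lambda>s. 36 * s * (1 - s) * (1 - 2 * s)) has_real_derivative 36 * (6 * s\<^sup>2 - 6 * s + 1)) (at s)"
    by (auto intro!: derivative_eq_intros simp: algebra_simps power2_eq_square)
  then show ?thesis
    unfolding deriv_W_pot[abs_def] by (rule DERIV_imp_deriv)
qed

lemma deriv_f_int: "deriv f_int s = 6 * s * (1 - s)"
proof -
  have "(f_int has_real_derivative 6 * s * (1 - s)) (at s)"
    unfolding f_int_def[abs_def]
    by (auto intro!: derivative_eq_intros simp: algebra_simps power2_eq_square)
  then show ?thesis by (rule DERIV_imp_deriv)
qed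

lemma deriv2_f_int: "deriv (deriv f_int) s = 6 - 12 * s"
proof -
  have "((\<lambda>s. 6 * s * (1 - s)) has_real_derivative 6 - 12 * s) (at s)"
    by (auto intro!: derivative_eq_intros simp: algebra_simps)
  then show ?thesis
    unfolding deriv_f_int[abs_def] by (rule DERIV_imp_deriv)
qed

text \<open>
  For a continuous function the essential supremum over an interval dominates every value,
  endpoints included.
\<close>

lemma Linf_norm_ge:
  fixes g :: "real \<Rightarrow> real"
  assumes g: "continuous_on UNIV g" and ab: "a < b" and s: "s \<in> {a..b}"
  shows "ereal \<bar>g s\<bar> \<le> Linf_norm (lebesgue_on {a..b}) g"
proof -
  let ?L = "Linf_norm (lebesgue_on {a..b}) g"
  let ?C = "{x. ereal \<bar>g x\<bar> \<le> ?L}"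
  have cont: "continuous_on UNIV (\<lambda>x. ereal \<bar>g x\<bar>)"
    by (intro continuous_intros g)
  have closed: "closed ?C"
    by (intro closed_Collect_le cont continuous_on_const)
  have "AE x in lebesgue_on {a..b}. x \<in> ?C"
    using esssup_AE[of "\<lambda>x. ereal \<bar>g x\<bar>" "lebesgue_on {a..b}"] by (simp add: Linf_norm_def)
  then have "AE x in lebesgue. x \<in> {a..b} \<longrightarrow> x \<in> ?C"
    by (subst (asm) AE_restrict_space_iff) auto
  then have "AE x\<in>{a<..<b} in lebesgue. x \<in> ?C"
    by eventually_elim auto
  then have "{a<..<b} \<subseteq> ?C"
    using mem_closed_if_AE_lebesgue_open[OF open_greaterThanLessThan closed] by blast
  then have "closure {a<..<b} \<subseteq> ?C"
    using closed by (rule closure_minimal)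
  then show ?thesis
    using s ab by (auto simp: closure_greaterThanLessThan)
qed

lemma f_int_unit:
  assumes "0 \<le> s" "s \<le> 1"
  shows "0 \<le> f_int s" "f_int s \<le> 1"
proof -
  have "f_int s = s\<^sup>2 * (3 - 2 * s)" "1 - f_int s = (1 - s)\<^sup>2 * (1 + 2 * s)"
    by (simp_all add: f_int_def algebra_simps power2_eq_square power3_eq_cube)
  moreover have "0 \<le> s\<^sup>2 * (3 - 2 * s)" "0 \<le> (1 - s)\<^sup>2 * (1 + 2 * s)"
    using assms by simp_all
  ultimately show "0 \<le> f_int s" "f_int s \<le> 1" by linarith+
qed

text \<open>
  The explicit part of the scheme maps the unit interval into \<open>[0, c]\<close>. The numbers 36 and 6 are the
  maxima of \<open>|W''|\<close> and \<open>|f''|\<close> on the unit interval. Instead of monotonicity in \<open>s\<close>, the proof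
  uses that \<open>W'\<close> and \<open>f'\<close> both contain the factor \<open>s (1 - s)\<close>.
\<close>

lemma source_bounds:
  assumes s: "0 \<le> s" "s \<le> 1" and \<epsilon>: "\<epsilon> > 0" and c: "36 / \<epsilon> + 6 * \<bar>A\<bar> \<le> c"
  shows "0 \<le> c * s - 1 / \<epsilon> * deriv W_pot s - A * deriv f_int s"
    and "c * s - 1 / \<epsilon> * deriv W_pot s - A * deriv f_int s \<le> c"
proof -
  have prod: "\<bar>x * y\<bar> \<le> 1" if "\<bar>x\<bar> \<le> 1" "\<bar>y\<bar> \<le> 1" for x y :: real
    using that by (simp add: abs_mult mult_le_one)
  have bound: "\<bar>36 / \<epsilon> * x\<bar> + \<bar>6 * A * y\<bar> \<le> c" if "\<bar>x\<bar> \<le> 1" "\<bar>y\<bar> \<le> 1" for x y :: real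
  proof -
    have "\<bar>36 / \<epsilon> * x\<bar> \<le> 36 / \<epsilon> * 1"
      using that \<epsilon> by (simp add: abs_mult divide_right_mono)
    moreover have "\<bar>6 * A * y\<bar> \<le> 6 * \<bar>A\<bar> * 1"
      unfolding abs_mult using that by (intro mult_mono) auto
    ultimately show ?thesis using c by linarith
  qed
  have unit: "\<bar>s\<bar> \<le> 1" "\<bar>1 - s\<bar> \<le> 1" "\<bar>1 - 2 * s\<bar> \<le> 1"
    using s by auto
  have "0 \<le> c - 36 / \<epsilon> * ((1 - s) * (1 - 2 * s)) - 6 * A * (1 - s)"
    using bound[OF prod[OF unit(2,3)] unit(2)] by linarith
  then have "0 \<le> s * (c - 36 / \<epsilon> * ((1 - s) * (1 - 2 * s)) - 6 * A * (1 - s))"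
    using s(1) by simp
  also have "\<dots> = c * s - 1 / \<epsilon> * deriv W_pot s - A * deriv f_int s"
    unfolding deriv_W_pot deriv_f_int
    by (simp add: algebra_simps add_divide_distrib diff_divide_distrib)
  finally show "0 \<le> c * s - 1 / \<epsilon> * deriv W_pot s - A * deriv f_int s" .
  have "0 \<le> c + 36 / \<epsilon> * (s * (1 - 2 * s)) + 6 * A * s"
    using bound[OF prod[OF unit(1,3)] unit(1)] by linarith
  then have "0 \<le> (1 - s) * (c + 36 / \<epsilon> * (s * (1 - 2 * s)) + 6 * A * s)"
    using s(2) by simp
  also have "\<dots> = c - (c * s - 1 / \<epsilon> * deriv W_pot s - A * deriv f_int s)"
    unfolding deriv_W_pot deriv_f_int
    by (simp add: algebra_simps add_divide_distrib diff_divide_distrib)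
  finally show "c * s - 1 / \<epsilon> * deriv W_pot s - A * deriv f_int s \<le> c" by simp
qed

section \<open>Bounds for the nonlocal terms\<close>

lemma weak_laplacian_cmult:
  assumes "weak_laplacian X u w"
  shows "weak_laplacian X (\<lambda>x. r * u x) (\<lambda>x. r * w x)"
  using assms by (simp add: weak_laplacian_def mult.assoc)

lemma is_inv_neg_laplacian_cmult:
  assumes "is_inv_neg_laplacian X g v"
  shows "is_inv_neg_laplacian X (\<lambda>x. r * g x) (\<lambda>x. r * v x)"
proof -
  have "weak_laplacian X (\<lambda>x. r * v x)
      (\<lambda>x. r * - (g x - (LINT y|torus X. g y) / torus_vol X))"
    using assms by (intro weak_laplacian_cmult) (simp add: is_inv_neg_laplacian_def)
  then show ?thesis
    using assms by (simp add: is_inv_neg_laplacian_def periodic_def algebra_simps)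
qed

lemma emeasure_torus_pos:
  fixes X :: "real^'d"
  assumes "\<And>i. X $ i > 0"
  shows "emeasure (torus X) (space (torus X)) \<noteq> 0"
proof -
  have "emeasure lborel (box (- X) X) > 0"
    using assms by (subst emeasure_lborel_box_eq) 
      (auto simp: cart_eq_inner_axis[symmetric] axis_inverse Basis_vec_def inner_axis less_imp_le
        intro!: prod_pos)
  moreover have "emeasure lborel (box (- X) X) \<le> emeasure lborel (cbox (- X) X)"
    by (intro emeasure_mono box_subset_cbox) auto
  ultimately show ?thesis
    by (simp add: torus_def emeasure_restrict_space)
qed

text \<open>
  The supremum is taken in the extended reals, so nonnegativity requires a member of the set: the
  zero function, whose norm is 0 and not \<open>- \<infinity>\<close> because the torus has positive measure.
\<close>

lemma inv_neg_laplacian_norm_nonneg: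
  fixes X :: "real^'d"
  assumes "\<And>i. X $ i > 0"
  shows "0 \<le> inv_neg_laplacian_norm X"
proof -
  have zero: "Linf_norm (torus X) (\<lambda>x. 0) = 0"
    using esssup_const[OF emeasure_torus_pos[OF assms], of "0::ereal"] by (simp add: Linf_norm_def zero_ereal_def)
  have "is_inv_neg_laplacian X (\<lambda>x. 0) (\<lambda>x. 0)"
    by (simp add: is_inv_neg_laplacian_def periodic_def weak_laplacian_def)
  then have "Linf_norm (torus X) (\<lambda>x. 0) \<le> inv_neg_laplacian_norm X"
    unfolding inv_neg_laplacian_norm_def using zero
    by (intro Sup_upper CollectI exI[of _ "\<lambda>x. 0"]) (simp add: periodic_def)
  then show ?thesis using zero by simp
qed

text \<open>
  The norm is a supremum over data in the unit ball, so the bound for general bounded \<open>g\<close> comes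
  from rescaling by \<open>1 / b\<close>.
\<close>

lemma inv_neg_laplacian_bound:
  fixes X :: "real^'d"
  assumes inv: "is_inv_neg_laplacian X g v" and g: "periodic X g" "g \<in> borel_measurable (torus X)"
    and b: "b > 0" "AE x in torus X. \<bar>g x\<bar> \<le> b"
    and B: "inv_neg_laplacian_norm X = ereal B"
  shows "AE x in torus X. \<bar>v x\<bar> \<le> b * B"
proof -
  let ?g = "\<lambda>x. 1 / b * g x" and ?v = "\<lambda>x. 1 / b * v x"
  have "Linf_norm (torus X) ?g \<le> 1"
    unfolding Linf_norm_def
  proof (rule esssup_I)
    show "(\<lambda>x. ereal \<bar>?g x\<bar>) \<in> borel_measurable (torus X)" using g(2) by simp
    show "AE x in torus X. ereal \<bar>?g x\<bar> \<le> 1"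
      using b(2) by eventually_elim (use b(1) in \<open>simp add: abs_mult field_simps\<close>)
  qed
  moreover have "periodic X ?g" using g(1) by (simp add: periodic_def)
  ultimately have "Linf_norm (torus X) ?v \<le> inv_neg_laplacian_norm X"
    unfolding inv_neg_laplacian_norm_def using is_inv_neg_laplacian_cmult[OF inv, of "1 / b"]
    by (intro Sup_upper) blast
  then have "Linf_norm (torus X) ?v \<le> ereal B" by (simp only: B)
  moreover have "AE x in torus X. ereal \<bar>?v x\<bar> \<le> Linf_norm (torus X) ?v"
    unfolding Linf_norm_def by (rule esssup_AE)
  ultimately have "AE x in torus X. ereal \<bar>?v x\<bar> \<le> ereal B"
    by (meson eventually_mono order_trans)
  then show ?thesis
    by eventually_elim (use b(1) in \<open>simp add: abs_mult field_simps\<close>)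
qed

lemma integral_torus_abs_le:
  fixes g :: "real^'d \<Rightarrow> real"
  assumes g: "g \<in> borel_measurable (torus X)" and b: "AE x in torus X. \<bar>g x\<bar> \<le> b"
  shows "\<bar>LINT x|torus X. g x\<bar> \<le> b * torus_vol X"
proof -
  have const: "integrable (torus X) (\<lambda>x. b)"
    by (rule integrable_torus_continuous) simp
  have g: "integrable (torus X) g"
    by (rule Bochner_Integration.integrable_bound[OF const g]) (use b in \<open>auto elim!: eventually_mono\<close>)
  have "\<bar>LINT x|torus X. g x\<bar> \<le> (LINT x|torus X. \<bar>g x\<bar>)"
    by (rule integral_abs_bound)
  also have "\<dots> \<le> (LINT x|torus X. b)"
    using g const b by (intro integral_mono_AE) auto
  also have "\<dots> = b * torus_vol X"
    by (simp add: torus_vol_def)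
  finally show ?thesis .
qed

text \<open>
  The stability condition implies that the norm of the inverse Laplacian is finite, since the right
  side would otherwise be infinite. Both norms of second derivatives are estimated from below by
  the values at 0, namely 36 and 6.
\<close>

lemma stability_real:
  fixes X :: "real^'d"
  assumes box: "\<And>i. X $ i > 0" and params: "\<epsilon> > 0" "\<gamma> > 0" "M > 0" "\<omega>' > 0"
    and stab: "ereal c \<ge>
        Linf_norm (lebesgue_on {0..1}) (deriv (deriv W_pot)) / ereal \<epsilon> +
        ereal \<omega>' * Linf_norm (lebesgue_on {0..1}) (deriv (deriv f_int)) *
          (ereal \<gamma> * inv_neg_laplacian_norm X + ereal (M * torus_vol X))"
  obtains B where "inv_neg_laplacian_norm X = ereal B" "0 \<le> B"
    "36 / \<epsilon> + 6 * (\<gamma> * (\<omega>' * B) + M * (\<omega>' * torus_vol X)) \<le> c"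
proof -
  let ?LW = "Linf_norm (lebesgue_on {0..1}) (deriv (deriv W_pot))"
  let ?Lf = "Linf_norm (lebesgue_on {0..1}) (deriv (deriv f_int))"
  let ?I = "inv_neg_laplacian_norm X"
  let ?V = "torus_vol X"
  have V: "0 \<le> ?V" by (simp add: torus_vol_def)
  have "continuous_on UNIV (deriv (deriv W_pot))" "continuous_on UNIV (deriv (deriv f_int))"
    unfolding deriv2_W_pot[abs_def] deriv2_f_int[abs_def] by (intro continuous_intros)+
  from this[THEN Linf_norm_ge, of 0 1 0] have L: "ereal 36 \<le> ?LW" "ereal 6 \<le> ?Lf"
    by (simp_all add: deriv2_W_pot deriv2_f_int)
  have I: "0 \<le> ?I" by (rule inv_neg_laplacian_norm_nonneg[OF box])
  have S: "0 \<le> ereal \<gamma> * ?I + ereal (M * ?V)"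
    using I V params by (intro add_nonneg_nonneg) auto
  have "ereal 36 / ereal \<epsilon> + ereal \<omega>' * ereal 6 * (ereal \<gamma> * ?I + ereal (M * ?V)) \<le>
      ?LW / ereal \<epsilon> + ereal \<omega>' * ?Lf * (ereal \<gamma> * ?I + ereal (M * ?V))"
    using L S params
    by (intro add_mono ereal_divide_right_mono ereal_mult_right_mono ereal_mult_left_mono) auto
  with stab have main: "ereal 36 / ereal \<epsilon> + ereal \<omega>' * ereal 6 * (ereal \<gamma> * ?I + ereal (M * ?V)) \<le> ereal c"
    by (rule order_trans[rotated])
  have "?I \<noteq> \<infinity>"
    using main params by auto
  then obtain B where B: "?I = ereal B" using I by (cases ?I) auto
  show thesis
  proof
    show "?I = ereal B" by (rule B)
    show "0 \<le> B" using I B by simp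
    show "36 / \<epsilon> + 6 * (\<gamma> * (\<omega>' * B) + M * (\<omega>' * ?V)) \<le> c"
      using main params by (simp add: B algebra_simps)
  qed
qed

section \<open>The maximum bound principle for the scheme\<close>

lemma scheme_step_bounds:
  fixes X :: "real^'d"
  assumes box: "\<And>i. X $ i > 0" and params: "\<epsilon> > 0" "\<gamma> > 0" "M > 0" "0 < \<omega>" "\<omega> < 1"
    and B: "inv_neg_laplacian_norm X = ereal B" "0 \<le> B"
    and stab: "36 / \<epsilon> + 6 * (\<gamma> * (max \<omega> (1 - \<omega>) * B) + M * (max \<omega> (1 - \<omega>) * torus_vol X))
      \<le> 1 / \<tau> + \<kappa> / \<epsilon>"
    and p: "periodic X p" "p \<in> borel_measurable (torus X)" "AE x in torus X. 0 \<le> p x \<and> p x \<le> 1"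
    and step: "scheme_step X \<epsilon> \<gamma> M \<kappa> \<omega> \<tau> p q"
  shows "AE x in torus X. 0 \<le> q x \<and> q x \<le> 1"
proof -
  define c where "c = 1 / \<tau> + \<kappa> / \<epsilon>"
  define b where "b = max \<omega> (1 - \<omega>)"
  let ?I = "LINT y|torus X. f_int (p y) - \<omega>"
  obtain v w where v: "is_inv_neg_laplacian X (\<lambda>x. f_int (p x) - \<omega>) v"
    and w: "weak_laplacian X q w"
    and eq: "AE x in torus X. c * (q x - p x) = \<epsilon> * w x - 1 / \<epsilon> * deriv W_pot (p x)
                 - \<gamma> * v x * deriv f_int (p x) - M * ?I * deriv f_int (p x)"
    using step by (auto simp: scheme_step_def c_def)
  have b: "b > 0" using params by (simp add: b_def)
  have V: "0 \<le> torus_vol X" by (simp add: torus_vol_def)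
  have stab': "36 / \<epsilon> + 6 * (\<gamma> * (b * B) + M * (b * torus_vol X)) \<le> c"
    using stab by (simp add: b_def c_def)
  have "0 < 36 / \<epsilon> + 6 * (\<gamma> * (b * B) + M * (b * torus_vol X))"
    using params b B V by (intro add_pos_nonneg mult_nonneg_nonneg add_nonneg_nonneg) auto
  with stab' have c: "c > 0" by (rule less_le_trans[rotated])
  have meas: "(\<lambda>x. f_int (p x) - \<omega>) \<in> borel_measurable (torus X)"
    unfolding f_int_def using p(2) by simp
  have per: "periodic X (\<lambda>x. f_int (p x) - \<omega>)"
    using p(1) by (simp add: periodic_def)
  have dev: "AE x in torus X. \<bar>f_int (p x) - \<omega>\<bar> \<le> b"
    using p(3)
  proof eventually_elim
    case (elim x)
    then show ?case using f_int_unit[of "p x"] by (auto simp: b_def)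
  qed
  have I: "\<bar>?I\<bar> \<le> b * torus_vol X"
    by (rule integral_torus_abs_le[OF meas dev])
  have "AE x in torus X. \<bar>v x\<bar> \<le> b * B"
    by (rule inv_neg_laplacian_bound[OF v per meas b dev B(1)])
  then have "AE x in torus X. 0 \<le> c * q x - \<epsilon> * w x \<and> c * q x - \<epsilon> * w x \<le> c"
    using eq p(3)
  proof eventually_elim
    case (elim x)
    \<comment> \<open>Both nonlocal terms multiply \<open>f'(p)\<close>; together they act as one coefficient.\<close>
    let ?A = "\<gamma> * v x + M * ?I"
    have "\<bar>?A\<bar> \<le> \<gamma> * \<bar>v x\<bar> + M * \<bar>?I\<bar>"
      using abs_triangle_ineq[of "\<gamma> * v x" "M * ?I"] params by (simp add: abs_mult)
    also have "\<dots> \<le> \<gamma> * (b * B) + M * (b * torus_vol X)"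
      using elim I params by (intro add_mono mult_left_mono) auto
    finally have "36 / \<epsilon> + 6 * \<bar>?A\<bar> \<le> c"
      by (intro order_trans[OF _ stab'] add_left_mono mult_left_mono) auto
    from source_bounds[OF _ _ params(1) this, of "p x"]
    have "0 \<le> c * p x - 1 / \<epsilon> * deriv W_pot (p x) - ?A * deriv f_int (p x)"
      "c * p x - 1 / \<epsilon> * deriv W_pot (p x) - ?A * deriv f_int (p x) \<le> c"
      using elim by auto
    moreover have "c * q x - \<epsilon> * w x = c * p x - 1 / \<epsilon> * deriv W_pot (p x) - ?A * deriv f_int (p x)"
      using elim by (simp add: algebra_simps)
    ultimately show ?case by simp
  qed
  then show ?thesis
    by (rule weak_comparison[OF box c params(1) w])
qed

theorem theorem3p1:
  fixes X :: "real^'d"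
    and \<epsilon> \<gamma> M \<kappa> \<omega> \<omega>' T \<tau> :: real
    and N :: nat
    and \<phi> :: "nat \<Rightarrow> real^'d \<Rightarrow> real"
  assumes dim: "CARD('d) = 2 \<or> CARD('d) = 3"
    and box: "\<And>i. X $ i > 0"
    and params: "\<epsilon> > 0" "\<gamma> > 0" "M > 0" "\<kappa> > 0" "0 < \<omega>" "\<omega> < 1"
    and omega': "\<omega>' = max \<omega> (1 - \<omega>)"
    and time: "T > 0" "N > 0" "\<tau> = T / real N"
    and init: "periodic X (\<phi> 0)" "\<phi> 0 \<in> borel_measurable (torus X)"
    and scheme: "\<And>n. n < N \<Longrightarrow> scheme_step X \<epsilon> \<gamma> M \<kappa> \<omega> \<tau> (\<phi> n) (\<phi> (Suc n))"
    and stab: "ereal (1 / \<tau> + \<kappa> / \<epsilon>) \<ge>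
        Linf_norm (lebesgue_on {0..1}) (deriv (deriv W_pot)) / ereal \<epsilon> +
        ereal \<omega>' * Linf_norm (lebesgue_on {0..1}) (deriv (deriv f_int)) *
          (ereal \<gamma> * inv_neg_laplacian_norm X + ereal (M * torus_vol X))"
    and init_bounds: "AE x in torus X. 0 \<le> \<phi> 0 x \<and> \<phi> 0 x \<le> 1"
  shows "\<forall>n\<in>{1..N}. AE x in torus X. 0 \<le> \<phi> n x \<and> \<phi> n x \<le> 1"
proof -
  have "\<omega>' > 0" using params omega' by simp
  then obtain B where B: "inv_neg_laplacian_norm X = ereal B" "0 \<le> B"
    and stab': "36 / \<epsilon> + 6 * (\<gamma> * (\<omega>' * B) + M * (\<omega>' * torus_vol X)) \<le> 1 / \<tau> + \<kappa> / \<epsilon>"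
    using stability_real[OF box params(1-3) _ stab] by blast
  have "periodic X (\<phi> n) \<and> \<phi> n \<in> borel_measurable (torus X) \<and>
      (AE x in torus X. 0 \<le> \<phi> n x \<and> \<phi> n x \<le> 1)" if "n \<le> N" for n
    using that
  proof (induction n)
    case 0
    then show ?case using init init_bounds by simp
  next
    case (Suc n)
    then have step: "scheme_step X \<epsilon> \<gamma> M \<kappa> \<omega> \<tau> (\<phi> n) (\<phi> (Suc n))"
      using scheme by simp
    then have "periodic X (\<phi> (Suc n))" "\<phi> (Suc n) \<in> borel_measurable (torus X)"
      by (auto simp: scheme_step_def weak_laplacian_def)
    moreover have "AE x in torus X. 0 \<le> \<phi> (Suc n) x \<and> \<phi> (Suc n) x \<le> 1"
      using Suc by (intro scheme_step_bounds[OF box params(1-3) params(5,6) B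
            stab'[unfolded omega'] _ _ _ step]) auto
    ultimately show ?case by blast
  qed
  then show ?thesis by simp
qed

end
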